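(* For every integer $n\geq 1$, the $\alpha$-Eulerian polynomial $A^*_n(x,y\,|\,\alpha)$ has the $\gamma$-expansion (expansion in $x+y$ and $xy$) $$A^*_n(x,y\,|\,\alpha)=\sum_{F} w(F),$$ where the sum ranges over all forests $F$ of planted increasing 0-1-2-plane trees on $[n]$.
   Context: Let $[m]=\{1,\dots,m\}$ and let $S_m$ be the set of permutations of $[m]$. For $\sigma\in S_m$, $\mathrm{asc}(\sigma)$, $\mathrm{des}(\sigma)$, $\mathrm{lrmin}(\sigma)$, $\mathrm{rlmin}(\sigma)$ are the numbers of ascents ($\sigma_{i-1}<\sigma_i$), descents ($\sigma_i>\sigma_{i+1}$), left-to-right minima and right-to-left minima of $\sigma$. The $\alpha$-Eulerian polynomial is $$A_n(x,y\,|\,\alpha)=\sum_{\sigma\in S_{n+1}}x^{\mathrm{des}(\sigma)}y^{\mathrm{asc}(\sigma)}\alpha^{\mathrm{lrmin}(\sigma)+\mathrm{rlmin}(\sigma)-2},$$ and $A^*_n(x,y\,|\,\alpha)=A_n(y,x\,|\,\alpha)$. An increasing 0-1-2-plane tree on a nonempty finite set $V$ of integers is a rooted plane tree whose vertices are labeled bijectively by $V$, in which every vertex has $0$, $1$ or $2$ children, the children of a vertex with two children are linearly ordered (left/right), a sole child carries no left/right distinction, and labels increase along every path going away from the root. A planted increasing 0-1-2-plane tree on a nonempty finite set $U$ is a root labeled $\min U$ which is either a single vertex (a single root, when $|U|=1$) or has exactly one child, this child being the root of an increasing 0-1-2-plane tree on $U\setminus\{\min U\}$. A forest of such trees on $[n]$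 is an unordered collection of planted increasing 0-1-2-plane trees whose label sets partition $[n]$. The weight $w(F)$ of such a forest $F$ is the product of the following vertex weights: each single root (root with no child) has weight $\alpha(x+y)$; each other root has weight $2\alpha$; each non-root vertex with exactly one child has weight $x+y$; each leaf (non-root vertex with no children) has weight $xy$; each vertex with two children has weight $1$. *)

theory Defs
  imports "HOL-Combinatorics.Permutations" "HOL-Library.Disjoint_Sets"
begin

text \<open>A permutation of \<open>[m]\<close> is a function \<open>\<sigma>\<close> with \<open>\<sigma> permutes {1..m}\<close>; its one-line notation
  is \<open>\<sigma> 1, \<dots>, \<sigma> m\<close>.\<close>

definition asc :: "nat \<Rightarrow> (nat \<Rightarrow> nat) \<Rightarrow> nat" where
  "asc m \<sigma> = card {i \<in> {2..m}. \<sigma> (i - 1) < \<sigma> i}"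

definition des :: "nat \<Rightarrow> (nat \<Rightarrow> nat) \<Rightarrow> nat" where
  "des m \<sigma> = card {i \<in> {1..<m}. \<sigma> i > \<sigma> (i + 1)}"

definition lrmin :: "nat \<Rightarrow> (nat \<Rightarrow> nat) \<Rightarrow> nat" where
  "lrmin m \<sigma> = card {i \<in> {1..m}. \<forall>j\<in>{1..<i}. \<sigma> i < \<sigma> j}"

definition rlmin :: "nat \<Rightarrow> (nat \<Rightarrow> nat) \<Rightarrow> nat" where
  "rlmin m \<sigma> = card {i \<in> {1..m}. \<forall>j\<in>{i<..m}. \<sigma> i < \<sigma> j}"

text \<open>The polynomials are given through their values at arbitrary elements of an arbitrary
  commutative ring. Taking for \<open>x\<close>, \<open>y\<close>, \<open>\<alpha>\<close> the indeterminates of a polynomial ring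
  recovers the formal polynomials. The truncated subtraction is harmless: for \<open>\<sigma>\<close>
  permuting \<open>{1..n+1}\<close> both \<open>lrmin\<close> and \<open>rlmin\<close> are at least 1.\<close>

definition alpha_Eulerian :: "nat \<Rightarrow> 'a::comm_ring_1 \<Rightarrow> 'a \<Rightarrow> 'a \<Rightarrow> 'a" where
  "alpha_Eulerian n x y \<alpha> =
     (\<Sum>\<sigma> | \<sigma> permutes {1..n+1}.
        x ^ des (n+1) \<sigma> * y ^ asc (n+1) \<sigma> * \<alpha> ^ (lrmin (n+1) \<sigma> + rlmin (n+1) \<sigma> - 2))"

definition alpha_Eulerian_star :: "nat \<Rightarrow> 'a::comm_ring_1 \<Rightarrow> 'a \<Rightarrow> 'a \<Rightarrow> 'a" where
  "alpha_Eulerian_star n x y \<alpha> = alpha_Eulerian n y x \<alpha>"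


datatype 'v tree012 =
    Leaf 'v
  | Unary 'v "'v tree012"
  | Binary 'v "'v tree012" "'v tree012"

fun tree_root :: "'v tree012 \<Rightarrow> 'v" where
  "tree_root (Leaf v) = v"
| "tree_root (Unary v t) = v"
| "tree_root (Binary v l r) = v"

fun vertex_labels :: "'v tree012 \<Rightarrow> 'v list" where
  "vertex_labels (Leaf v) = [v]"
| "vertex_labels (Unary v t) = v # vertex_labels t"
| "vertex_labels (Binary v l r) = v # vertex_labels l @ vertex_labels r"

fun increasing :: "'v::linorder tree012 \<Rightarrow> bool" where
  "increasing (Leaf v) = True"
| "increasing (Unary v t) = (v < tree_root t \<and> increasing t)"
| "increasing (Binary v l r) =
     (v < tree_root l \<and> v < tree_root r \<and> increasing l \<and> increasing r)"

text \<open>The list of vertex labels has one entry per vertex, so its distinctness together with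
  its set of entries being \<open>V\<close> says that the labelling is a bijection onto \<open>V\<close>.\<close>

definition increasing_tree_on :: "'v::linorder set \<Rightarrow> 'v tree012 \<Rightarrow> bool" where
  "increasing_tree_on V t \<longleftrightarrow>
     distinct (vertex_labels t) \<and> set (vertex_labels t) = V \<and> increasing t"

datatype 'v planted =
    SingleRoot 'v
  | PlantedRoot 'v "'v tree012"

fun planted_labels :: "'v planted \<Rightarrow> 'v set" where
  "planted_labels (SingleRoot v) = {v}"
| "planted_labels (PlantedRoot v t) = insert v (set (vertex_labels t))"

fun planted_increasing_tree_on :: "'v::linorder set \<Rightarrow> 'v planted \<Rightarrow> bool" where
  "planted_increasing_tree_on U (SingleRoot v) \<longleftrightarrow> U = {v}"
| "planted_increasing_tree_on U (PlantedRoot v t) \<longleftrightarrow>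
     finite U \<and> U \<noteq> {} \<and> v = Min U \<and> increasing_tree_on (U - {v}) t"

text \<open>Trees in a forest have nonempty disjoint label sets and are therefore pairwise different,
  so an unordered collection is a set. Injectivity of \<open>planted_labels\<close> excludes two different
  trees of the forest carrying the same label set.\<close>

definition forest_on :: "'v::linorder set \<Rightarrow> 'v planted set \<Rightarrow> bool" where
  "forest_on N F \<longleftrightarrow>
     (\<forall>T\<in>F. planted_increasing_tree_on (planted_labels T) T) \<and>
     inj_on planted_labels F \<and> partition_on N (planted_labels ` F)"

fun tree_weight :: "'a::comm_ring_1 \<Rightarrow> 'a \<Rightarrow> 'v tree012 \<Rightarrow> 'a" where
  "tree_weight x y (Leaf v) = x * y"
| "tree_weight x y (Unary v t) = (x + y) * tree_weight x y t"
| "tree_weight x y (Binary v l r) = 1 * tree_weight x y l * tree_weight x y r"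

fun planted_weight :: "'a::comm_ring_1 \<Rightarrow> 'a \<Rightarrow> 'a \<Rightarrow> 'v planted \<Rightarrow> 'a" where
  "planted_weight x y \<alpha> (SingleRoot v) = \<alpha> * (x + y)"
| "planted_weight x y \<alpha> (PlantedRoot v t) = 2 * \<alpha> * tree_weight x y t"

definition forest_weight :: "'a::comm_ring_1 \<Rightarrow> 'a \<Rightarrow> 'a \<Rightarrow> 'v planted set \<Rightarrow> 'a" where
  "forest_weight x y \<alpha> F = (\<Prod>T\<in>F. planted_weight x y \<alpha> T)"


text \<open>The sum over all forests on a finite set is a genuine finite sum.\<close>

lemma finite_trees_bounded:
  assumes "finite A"
  shows "finite {t. set (vertex_labels t) \<subseteq> A \<and> length (vertex_labels t) \<le> k}"
proof (induction k)
  case 0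
  have "vertex_labels t \<noteq> []" for t :: "'a tree012" by (cases t) auto
  then show ?case by simp
next
  case (Suc k)
  let ?S = "{t. set (vertex_labels t) \<subseteq> A \<and> length (vertex_labels t) \<le> k}"
  have "{t. set (vertex_labels t) \<subseteq> A \<and> length (vertex_labels t) \<le> Suc k}
      \<subseteq> Leaf ` A \<union> (\<lambda>(v, t). Unary v t) ` (A \<times> ?S)
        \<union> (\<lambda>(v, l, r). Binary v l r) ` (A \<times> ?S \<times> ?S)" (is "?L \<subseteq> ?R")
  proof
    fix t assume "t \<in> ?L"
    then show "t \<in> ?R" by (cases t) (auto simp: image_iff)
  qed
  then show ?case by (rule finite_subset) (intro finite_UnI finite_imageI finite_cartesian_product assms Suc.IH)
qed

lemma finite_forests_on:
  assumes "finite N"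
  shows "finite {F. forest_on N F}"
proof -
  let ?S = "{t. set (vertex_labels t) \<subseteq> N \<and> length (vertex_labels t) \<le> card N}"
  let ?P = "SingleRoot ` N \<union> (\<lambda>(v, t). PlantedRoot v t) ` (N \<times> ?S)"
  have "F \<subseteq> ?P" if F: "forest_on N F" for F
  proof
    fix T assume T: "T \<in> F"
    have sub: "planted_labels T \<subseteq> N"
      using F T by (auto simp: forest_on_def partition_on_def)
    have on: "planted_increasing_tree_on (planted_labels T) T"
      using F T by (auto simp: forest_on_def)
    show "T \<in> ?P"
    proof (cases T)
      case (PlantedRoot v t)
      have "distinct (vertex_labels t)"
        using on PlantedRoot by (auto simp: increasing_tree_on_def)
      moreover have "set (vertex_labels t) \<subseteq> N" "v \<in> N"
        using sub PlantedRoot by auto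
      ultimately have "length (vertex_labels t) \<le> card N"
        using card_mono[OF assms] distinct_card by metis
      then show ?thesis using PlantedRoot \<open>v \<in> N\<close> \<open>set (vertex_labels t) \<subseteq> N\<close> by auto
    qed (use sub in auto)
  qed
  then have "{F. forest_on N F} \<subseteq> Pow ?P" by blast
  moreover have "finite ?P"
    by (intro finite_UnI finite_imageI finite_cartesian_product assms finite_trees_bounded)
  ultimately show ?thesis by (meson finite_Pow_iff finite_subset)
qed

end

(* Build permutations by inserting the largest letter and forests by attaching the largest label.
   Inserting a new maximum at either end creates a new left-to-right or right-to-left minimum
   (factor alpha) and a descent or ascent; inserting it into a descent (ascent) turns that factor x
   or y into x y. So A_{n+1} = alpha (x + y) A_n + x y (d/dx + d/dy) A_n. On u = x + y and v = x y
   the derivation acts by u -> 2 v and v -> u v, which is how forests grow: a new single root gives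
   alpha u; a one-child vertex, of weight u, takes a second leaf child on the left or on the right;
   a single root, of weight alpha u, takes a leaf child and becomes 2 alpha v; a leaf, of weight v,
   becomes a one-child vertex above a new leaf.

   An arbitrary commutative ring carries no such derivation; both recurrences, however, hold with
   an arbitrary function f of the exponents in place of the monomials. *)

theory Submission
  imports Defs
begin

section \<open>Changing variables from x, y to x + y, xy\<close>

text \<open>With \<open>f d a\<close> read as y^d x^a this is alpha (x + y) + x y (d/dx + d/dy),
  written on exponents alone. The last two terms count slots: filling one of \<open>d\<close>
  descents adds an ascent, filling one of \<open>a\<close> ascents adds a descent.\<close>

definition insertion_op :: "'a::comm_ring_1 \<Rightarrow> (nat \<Rightarrow> nat \<Rightarrow> 'a) \<Rightarrow> nat \<Rightarrow> nat \<Rightarrow> 'a" where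
  "insertion_op \<alpha> f d a =
     \<alpha> * (f (Suc d) a + f d (Suc a)) + of_nat d * f d (Suc a) + of_nat a * f (Suc d) a"

text \<open>The same operator in u = x + y and v = x y: alpha u + 2 v d/du + u v d/dv, applied to
  u^p v^q. The truncated \<open>p - 1\<close> is harmless because its term carries the factor
  \<open>p\<close>.\<close>

definition growth_op :: "'a::comm_ring_1 \<Rightarrow> (nat \<Rightarrow> nat \<Rightarrow> 'a) \<Rightarrow> nat \<Rightarrow> nat \<Rightarrow> 'a" where
  "growth_op \<alpha> g p q =
     \<alpha> * g (Suc p) q + (2 * of_nat p * g (p - 1) (Suc q) + of_nat q * g (Suc p) q)"

text \<open>If \<open>f d a\<close> stands for \<open>y\<^sup>d x\<^sup>a\<close>, then \<open>gamma_expand f p q\<close> stands for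
  \<open>(x + y)\<^sup>p (x y)\<^sup>q\<close>.\<close>

definition gamma_expand :: "(nat \<Rightarrow> nat \<Rightarrow> 'a::comm_ring_1) \<Rightarrow> nat \<Rightarrow> nat \<Rightarrow> 'a" where
  "gamma_expand f p q = (\<Sum>i\<le>p. of_nat (p choose i) * f (q + i) (q + p - i))"

text \<open>One more factor x + y, by Pascal's rule. It has to be done on coefficients, as
  \<open>f\<close> need not be multiplicative.\<close>

lemma gamma_expand_Suc:
  "gamma_expand f (Suc p) q =
     (\<Sum>i\<le>p. of_nat (p choose i) * (f (Suc (q + i)) (q + p - i) + f (q + i) (Suc (q + p - i))))"
proof -
  have "gamma_expand f (Suc p) q =
      f q (Suc (q + p)) + (\<Sum>i\<le>p. of_nat (Suc p choose Suc i) * f (Suc (q + i)) (q + p - i))"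
    unfolding gamma_expand_def by (subst sum.atMost_Suc_shift) simp
  also have "\<dots> = (\<Sum>i\<le>p. of_nat (p choose i) * f (Suc (q + i)) (q + p - i)) +
      (f q (Suc (q + p)) + (\<Sum>i\<le>p. of_nat (p choose Suc i) * f (Suc (q + i)) (q + p - i)))"
    by (simp add: sum.distrib distrib_right)
  \<comment> \<open>The term split off at \<open>i = 0\<close> becomes the first summand again; the
    last one, with \<open>p choose Suc p\<close>, is zero.\<close>
  also have "f q (Suc (q + p)) + (\<Sum>i\<le>p. of_nat (p choose Suc i) * f (Suc (q + i)) (q + p - i)) =
      (\<Sum>i\<le>Suc p. of_nat (p choose i) * f (q + i) (Suc (q + p) - i))"
    by (subst sum.atMost_Suc_shift) simp
  also have "\<dots> = (\<Sum>i\<le>p. of_nat (p choose i) * f (q + i) (Suc (q + p - i)))"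
    by (simp add: Suc_diff_le binomial_eq_0)
  finally show ?thesis
    by (simp add: sum.distrib algebra_simps)
qed

text \<open>The coefficient form of d/dy (x + y)^p = p (x + y)^(p - 1), from i C(p, i) = p C(p - 1,
  i - 1). At \<open>p = 0\<close> both sides are zero.\<close>

lemma sum_binomial_absorb:
  fixes h :: "nat \<Rightarrow> 'a::comm_ring_1"
  shows "(\<Sum>i\<le>p. of_nat (p choose i) * of_nat i * h i) =
    of_nat p * (\<Sum>i\<le>p - 1. of_nat (p - 1 choose i) * h (Suc i))"
proof (cases p)
  case (Suc k)
  have *: "of_nat (Suc k choose Suc i) * of_nat (Suc i) = (of_nat (Suc k) * of_nat (k choose i) :: 'a)" for i
    by (metis Suc_times_binomial_eq mult.commute of_nat_mult)
  show ?thesis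
    unfolding Suc by (subst sum.atMost_Suc_shift)
      (simp only: *, simp add: sum_distrib_left mult.assoc)
qed simp

text \<open>The companion for d/dx, from (p - i) C(p, i) = p C(p - 1, i).\<close>

lemma sum_binomial_absorb':
  fixes h :: "nat \<Rightarrow> 'a::comm_ring_1"
  shows "(\<Sum>i\<le>p. of_nat (p choose i) * of_nat (p - i) * h i) =
    of_nat p * (\<Sum>i\<le>p - 1. of_nat (p - 1 choose i) * h i)"
proof (cases p)
  case (Suc k)
  have *: "of_nat (Suc k choose i) * of_nat (Suc k - i) = (of_nat (Suc k) * of_nat (k choose i) :: 'a)" for i
    by (metis binomial_absorb_comp mult.commute of_nat_mult diff_Suc_1)
  show ?thesis
    unfolding Suc by (simp only: *, simp add: sum_distrib_left mult.assoc binomial_eq_0)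
qed simp

text \<open>This is the chain rule. Summand \<open>i\<close> has exponents q + i and q + (p - i):
  the two parts q together supply one more factor x + y, while i and p - i are absorbed into the
  binomials.\<close>

lemma gamma_expand_insertion_op:
  "gamma_expand (insertion_op \<alpha> f) = growth_op \<alpha> (gamma_expand f)"
proof (intro ext)
  fix p q
  let ?C = "\<lambda>i. of_nat (p choose i) :: 'a"
  let ?f1 = "\<lambda>i. f (Suc (q + i)) (q + p - i)" and ?f2 = "\<lambda>i. f (q + i) (Suc (q + p - i))"
  have s: "of_nat (q + p - i) = (of_nat q + of_nat (p - i) :: 'a)" if "i \<le> p" for i
    using that by (metis Nat.add_diff_assoc of_nat_add)
  have "gamma_expand (insertion_op \<alpha> f) p q =
      (\<Sum>i\<le>p. \<alpha> * (?C i * (?f1 i + ?f2 i)) + of_nat q * (?C i * (?f1 i + ?f2 i)) +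
        ?C i * of_nat i * ?f2 i + ?C i * of_nat (p - i) * ?f1 i)"
    unfolding gamma_expand_def insertion_op_def
    by (intro sum.cong refl) (simp add: s algebra_simps)
  also have "\<dots> = \<alpha> * gamma_expand f (Suc p) q + of_nat q * gamma_expand f (Suc p) q +
      of_nat p * (\<Sum>i\<le>p - 1. of_nat (p - 1 choose i) * ?f2 (Suc i)) +
      of_nat p * (\<Sum>i\<le>p - 1. of_nat (p - 1 choose i) * ?f1 i)"
    unfolding sum.distrib gamma_expand_Suc sum_binomial_absorb sum_binomial_absorb'
    by (simp add: sum_distrib_left)
  \<comment> \<open>Both absorbed sums turn out to be the same expansion; this is the 2 in
    \<open>growth_op\<close>.\<close>
  also have "of_nat p * (\<Sum>i\<le>p - 1. of_nat (p - 1 choose i) * ?f2 (Suc i)) =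
      of_nat p * gamma_expand f (p - 1) (Suc q)"
    by (cases p) (auto simp: gamma_expand_def intro!: arg_cong2[where f = "(*)"] sum.cong arg_cong2[where f = f])
  also have "of_nat p * (\<Sum>i\<le>p - 1. of_nat (p - 1 choose i) * ?f1 i) =
      of_nat p * gamma_expand f (p - 1) (Suc q)"
    by (cases p) (auto simp: gamma_expand_def intro!: arg_cong2[where f = "(*)"] sum.cong arg_cong2[where f = f])
  finally show "gamma_expand (insertion_op \<alpha> f) p q = growth_op \<alpha> (gamma_expand f) p q"
    by (simp add: growth_op_def algebra_simps)
qed

lemma gamma_expand_monomial:
  "gamma_expand (\<lambda>d a. y ^ d * x ^ a) p q = (x + y) ^ p * (x * y) ^ q"
proof -
  have "of_nat (p choose i) * (y ^ (q + i) * x ^ (q + p - i)) =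
      of_nat (p choose i) * y ^ i * x ^ (p - i) * (x * y) ^ q" if "i \<le> p" for i
    using that by (simp only: Nat.add_diff_assoc[symmetric] power_add power_mult_distrib) (simp add: mult_ac)
  then have "gamma_expand (\<lambda>d a. y ^ d * x ^ a) p q = (y + x) ^ p * (x * y) ^ q"
    unfolding gamma_expand_def binomial_ring sum_distrib_right by (intro sum.cong) auto
  then show ?thesis by (simp add: add.commute)
qed

section \<open>Inserting the largest letter into a permutation\<close>

text \<open>A permutation \<open>\<tau>\<close> of \<open>{1..m}\<close> fixes \<open>m + 1\<close>, so the one-line notation of
  \<open>\<tau> \<circ> slot_perm m j\<close> is that of \<open>\<tau>\<close> with \<open>m + 1\<close> inserted at position \<open>j\<close>.\<close>

definition slot_perm :: "nat \<Rightarrow> nat \<Rightarrow> nat \<Rightarrow> nat" where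
  "slot_perm m j i =
     (if i < j \<or> i > Suc m then i else if i = j then Suc m else i - 1)"

lemma slot_perm_permutes:
  assumes "j \<in> {1..Suc m}"
  shows "slot_perm m j permutes {1..Suc m}"
proof (rule bij_imp_permutes)
  show "bij_betw (slot_perm m j) {1..Suc m} {1..Suc m}"
    \<comment> \<open>The inverse moves \<open>j\<close>, ..., \<open>m\<close> one place to the
      right and sends \<open>Suc m\<close> back to \<open>j\<close>.\<close>
    by (rule bij_betw_byWitness[where f' = "\<lambda>i. if i < j then i else if i \<le> m then Suc i else j"])
      (use assms in \<open>auto simp: slot_perm_def\<close>)
qed (use assms in \<open>auto simp: slot_perm_def\<close>)

lemma insert_permutes:
  assumes "\<tau> permutes {1..m}" "j \<in> {1..Suc m}"
  shows "\<tau> \<circ> slot_perm m j permutes {1..Suc m}"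
proof (rule permutes_compose[OF slot_perm_permutes[OF assms(2)]])
  show "\<tau> permutes {1..Suc m}" by (rule permutes_subset[OF assms(1)]) auto
qed

text \<open>A permutation is determined by the position of its largest letter and by what remains
  after deleting that letter.\<close>

lemma sum_permutes_Suc:
  "(\<Sum>\<sigma> | \<sigma> permutes {1..Suc m}. h \<sigma>) =
   (\<Sum>\<tau> | \<tau> permutes {1..m}. \<Sum>j\<in>{1..Suc m}. h (\<tau> \<circ> slot_perm m j))"
proof -
  let ?pos = "\<lambda>\<sigma> :: nat \<Rightarrow> nat. inv \<sigma> (Suc m)"
  have pos: "?pos (\<tau> \<circ> slot_perm m j) = j" if "\<tau> permutes {1..m}" "j \<in> {1..Suc m}" for \<tau> j
  proof -
    have "(\<tau> \<circ> slot_perm m j) j = Suc m"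
      using that permutes_not_in[OF that(1), of "Suc m"] by (simp add: slot_perm_def)
    then show ?thesis
      by (rule permutes_inv_eq[OF insert_permutes[OF that], THEN iffD2])
  qed
  have pos_in: "?pos \<sigma> \<in> {1..Suc m}" if "\<sigma> permutes {1..Suc m}" for \<sigma>
    using permutes_in_image[OF permutes_inv[OF that], of "Suc m"] by simp
  \<comment> \<open>Undoing the insertion leaves a permutation of \<open>{1..Suc m}\<close> that
    fixes \<open>Suc m\<close>, hence one of \<open>{1..m}\<close>.\<close>
  have restrict: "\<sigma> \<circ> inv (slot_perm m (?pos \<sigma>)) permutes {1..m}" if \<sigma>: "\<sigma> permutes {1..Suc m}" for \<sigma>
  proof (rule permutes_superset)
    have s: "slot_perm m (?pos \<sigma>) permutes {1..Suc m}"
      by (rule slot_perm_permutes[OF pos_in[OF \<sigma>]])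
    show "\<sigma> \<circ> inv (slot_perm m (?pos \<sigma>)) permutes {1..Suc m}"
      by (rule permutes_compose[OF permutes_inv[OF s] \<sigma>])
    have "slot_perm m (?pos \<sigma>) (?pos \<sigma>) = Suc m"
      using pos_in[OF \<sigma>] by (simp add: slot_perm_def)
    then have "inv (slot_perm m (?pos \<sigma>)) (Suc m) = ?pos \<sigma>"
      using permutes_inv_eq[OF s] by blast
    then show "(\<sigma> \<circ> inv (slot_perm m (?pos \<sigma>))) i = i" if "i \<in> {1..Suc m} - {1..m}" for i
    proof -
      have "i = Suc m" using that by auto
      then show ?thesis
        using \<open>inv (slot_perm m (?pos \<sigma>)) (Suc m) = ?pos \<sigma>\<close> permutes_inverses(1)[OF \<sigma>] by simp
    qed
  qed
  have "(\<Sum>\<sigma> | \<sigma> permutes {1..Suc m}. h \<sigma>) =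
      (\<Sum>(\<tau>, j)\<in>{\<tau>. \<tau> permutes {1..m}} \<times> {1..Suc m}. h (\<tau> \<circ> slot_perm m j))"
    by (rule sum.reindex_bij_witness[where
          j = "\<lambda>\<sigma>. (\<sigma> \<circ> inv (slot_perm m (?pos \<sigma>)), ?pos \<sigma>)" and
          i = "\<lambda>(\<tau>, j). \<tau> \<circ> slot_perm m j"])
      (use pos pos_in restrict insert_permutes slot_perm_permutes in
        \<open>auto simp: comp_assoc permutes_inv_o[OF slot_perm_permutes] simp del: atLeastAtMost_iff\<close>)
  then show ?thesis unfolding sum.cartesian_product .
qed

section \<open>Effect of an insertion on ascents, descents and minima\<close>

definition ascents :: "nat \<Rightarrow> (nat \<Rightarrow> nat) \<Rightarrow> nat set" where
  "ascents m \<sigma> = {i \<in> {1..<m}. \<sigma> i < \<sigma> (Suc i)}"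

definition descents :: "nat \<Rightarrow> (nat \<Rightarrow> nat) \<Rightarrow> nat set" where
  "descents m \<sigma> = {i \<in> {1..<m}. \<sigma> i > \<sigma> (Suc i)}"

lemma finite_ascents [simp]: "finite (ascents m \<sigma>)" and finite_descents [simp]: "finite (descents m \<sigma>)"
  by (auto simp: ascents_def descents_def)

lemma des_eq_card: "des m \<sigma> = card (descents m \<sigma>)"
  by (simp add: des_def descents_def)

text \<open>\<open>asc\<close> indexes an ascent by its right end, \<open>ascents\<close> by its
  left end, so that ascents and descents share the index set \<open>{1..<m}\<close>.\<close>

lemma asc_eq_card: "asc m \<sigma> = card (ascents m \<sigma>)"
proof -
  have "{i \<in> {2..m}. \<sigma> (i - 1) < \<sigma> i} = Suc ` ascents m \<sigma>"
  proof (intro equalityI subsetI)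
    fix i assume "i \<in> {i \<in> {2..m}. \<sigma> (i - 1) < \<sigma> i}"
    then show "i \<in> Suc ` ascents m \<sigma>"
      by (intro image_eqI[where x = "i - 1"]) (auto simp: ascents_def)
  qed (auto simp: ascents_def)
  then show ?thesis by (simp add: asc_def card_image)
qed

lemma ascents_Un_descents:
  assumes "\<sigma> permutes {1..m}"
  shows "ascents m \<sigma> \<union> descents m \<sigma> = {1..<m}" "ascents m \<sigma> \<inter> descents m \<sigma> = {}"
proof -
  have "\<sigma> i \<noteq> \<sigma> (Suc i)" for i
    using permutes_inj[OF assms] by (metis inj_eq n_not_Suc_n)
  then show "ascents m \<sigma> \<union> descents m \<sigma> = {1..<m}"
    by (auto simp: ascents_def descents_def linorder_neq_iff)
  show "ascents m \<sigma> \<inter> descents m \<sigma> = {}"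
    by (auto simp: ascents_def descents_def)
qed

lemma insert_apply:
  assumes "\<tau> permutes {1..m}" "i \<le> Suc m" "j \<le> Suc m"
  shows "(\<tau> \<circ> slot_perm m j) i = (if i < j then \<tau> i else if i = j then Suc m else \<tau> (i - 1))"
  using assms permutes_not_in[OF assms(1), of "Suc m"] by (simp add: slot_perm_def)

lemma permutes_atMost_le:
  assumes "\<tau> permutes {1..m}" "i \<in> {1..m}"
  shows "\<tau> i < Suc m"
  using permutes_in_image[OF assms(1), of i] assms(2) by simp

text \<open>Only the adjacent pair starting at \<open>j - 1\<close> is broken up. The new letter is
  larger than both neighbours, so an ascent leads into it unless it comes first.\<close>

lemma asc_insert:
  assumes \<tau>: "\<tau> permutes {1..m}" and j: "j \<in> {1..Suc m}"
  shows "asc (Suc m) (\<tau> \<circ> slot_perm m j) = card (ascents m \<tau> - {j - 1}) + of_bool (1 < j)"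
proof -
  \<comment> \<open>New left end of a surviving pair: pairs to the right of the slot move by
    one.\<close>
  let ?f = "\<lambda>i. if i < j - 1 then i else Suc i"
  note ap = insert_apply[OF \<tau>, of _ j] and le = permutes_atMost_le[OF \<tau>]
  have "ascents (Suc m) (\<tau> \<circ> slot_perm m j) = ?f ` (ascents m \<tau> - {j - 1}) \<union> (if 1 < j then {j - 1} else {})"
    (is "?A = ?B")
  proof (intro equalityI subsetI)
    fix i assume i: "i \<in> ?A"
    then have i': "i \<in> {1..m}" "(\<tau> \<circ> slot_perm m j) i < (\<tau> \<circ> slot_perm m j) (Suc i)"
      by (auto simp: ascents_def)
    consider "i < j - 1" | "i = j - 1" | "i = j" | "i > j" by linarith
    then show "i \<in> ?B"
    proof cases
      case 1
      then have "Suc i < j" by simp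
      then have "i \<in> ascents m \<tau> - {j - 1}" using i' j by (auto simp: ascents_def ap simp del: o_apply)
      then show ?thesis using 1 by force
    next
      case 3
      then show ?thesis using i' j le[of i] by (auto simp: ap simp del: o_apply)
    next
      case 4
      then have "i - 1 \<in> ascents m \<tau> - {j - 1}" using i' j by (auto simp: ascents_def ap simp del: o_apply)
      moreover have "i = ?f (i - 1)" using 4 by auto
      ultimately show ?thesis by blast
    qed (use i' in auto)
  next
    fix i assume "i \<in> ?B"
    then have "i \<in> ?f ` (ascents m \<tau> - {j - 1}) \<or> 1 < j \<and> i = j - 1"
      by (simp only: Un_iff split: if_split_asm) blast+
    then consider k where "k \<in> ascents m \<tau>" "k \<noteq> j - 1" "i = ?f k" | "1 < j" "i = j - 1"
      by blast
    then show "i \<in> ?A"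
    proof cases
      case 1
      then show ?thesis using j by (auto simp: ascents_def ap simp del: o_apply)
    next
      case 2
      then have "j - 1 \<in> {1..m}" using j unfolding atLeastAtMost_iff by linarith
      then show ?thesis using 2 j le[of "j - 1"] by (auto simp: ascents_def ap simp del: o_apply)
    qed
  qed
  moreover have "inj ?f" by (auto simp: inj_on_def)
  then have "card (?f ` (ascents m \<tau> - {j - 1})) = card (ascents m \<tau> - {j - 1})"
    by (intro card_image) (auto intro: inj_on_subset)
  moreover have "j - 1 \<notin> ?f ` (ascents m \<tau> - {j - 1})" by auto
  ultimately show ?thesis unfolding asc_eq_card by (auto simp: card_insert_if)
qed

text \<open>Mirror image of \<open>asc_insert\<close>; the new descent starts at the inserted letter
  itself, so its index is \<open>j\<close> and not \<open>j - 1\<close>.\<close>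

lemma des_insert:
  assumes \<tau>: "\<tau> permutes {1..m}" and j: "j \<in> {1..Suc m}"
  shows "des (Suc m) (\<tau> \<circ> slot_perm m j) = card (descents m \<tau> - {j - 1}) + of_bool (j \<le> m)"
proof -
  let ?f = "\<lambda>i. if i < j - 1 then i else Suc i"
  note ap = insert_apply[OF \<tau>, of _ j] and le = permutes_atMost_le[OF \<tau>]
  have "descents (Suc m) (\<tau> \<circ> slot_perm m j) = ?f ` (descents m \<tau> - {j - 1}) \<union> (if j \<le> m then {j} else {})"
    (is "?A = ?B")
  proof (intro equalityI subsetI)
    fix i assume i: "i \<in> ?A"
    then have i': "i \<in> {1..m}" "(\<tau> \<circ> slot_perm m j) i > (\<tau> \<circ> slot_perm m j) (Suc i)"
      by (auto simp: descents_def)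
    consider "i < j - 1" | "i = j - 1" | "i = j" | "i > j" by linarith
    then show "i \<in> ?B"
    proof cases
      case 1
      then have "Suc i < j" by simp
      then have "i \<in> descents m \<tau> - {j - 1}" using i' j by (auto simp: descents_def ap simp del: o_apply)
      then show ?thesis using 1 by force
    next
      case 2
      then show ?thesis using i' j le[of i] by (auto simp: ap simp del: o_apply)
    next
      case 4
      then have "i - 1 \<in> descents m \<tau> - {j - 1}" using i' j by (auto simp: descents_def ap simp del: o_apply)
      moreover have "i = ?f (i - 1)" using 4 by auto
      ultimately show ?thesis by blast
    qed (use i' in auto)
  next
    fix i assume "i \<in> ?B"
    then have "i \<in> ?f ` (descents m \<tau> - {j - 1}) \<or> j \<le> m \<and> i = j"
      by (simp only: Un_iff split: if_split_asm) blast+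
    then consider k where "k \<in> descents m \<tau>" "k \<noteq> j - 1" "i = ?f k" | "j \<le> m" "i = j"
      by blast
    then show "i \<in> ?A"
    proof cases
      case 1
      then show ?thesis using j by (auto simp: descents_def ap simp del: o_apply)
    next
      case 2
      then show ?thesis using j le[of j] by (auto simp: descents_def ap simp del: o_apply)
    qed
  qed
  moreover have "inj ?f" by (auto simp: inj_on_def)
  then have "card (?f ` (descents m \<tau> - {j - 1})) = card (descents m \<tau> - {j - 1})"
    by (intro card_image) (auto intro: inj_on_subset)
  moreover have "j \<notin> ?f ` (descents m \<tau> - {j - 1})" by auto
  ultimately show ?thesis unfolding des_eq_card by (auto simp: card_insert_if)
qed

text \<open>A largest letter never spoils a comparison that an old letter has to win, and is itself
  a minimum only if nothing precedes (or follows) it.\<close>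

lemma lrmin_rlmin_insert:
  assumes \<tau>: "\<tau> permutes {1..m}" and j: "j \<in> {1..Suc m}" and m: "1 \<le> m"
  shows "lrmin (Suc m) (\<tau> \<circ> slot_perm m j) = lrmin m \<tau> + of_bool (j = 1)"
    and "rlmin (Suc m) (\<tau> \<circ> slot_perm m j) = rlmin m \<tau> + of_bool (j = Suc m)"
proof -
  \<comment> \<open>\<open>?g\<close> embeds the old positions, in order, into the positions other
    than \<open>j\<close>.\<close>
  let ?g = "\<lambda>i. if i < j then i else Suc i" and ?\<sigma> = "\<tau> \<circ> slot_perm m j"
  note ap = insert_apply[OF \<tau>, of _ j] and le = permutes_atMost_le[OF \<tau>]
  have less: "?g k < ?g i \<longleftrightarrow> k < i" for i k by auto
  have inj: "inj_on ?g A" for A by (auto simp: inj_on_def)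
  have old: "?\<sigma> (?g i) = \<tau> i" if "i \<in> {1..m}" for i
    using ap[of i] ap[of "Suc i"] that j by auto
  have new: "?\<sigma> j = Suc m" using ap[of j] j by simp
  have cover: "{1..Suc m} = insert j (?g ` {1..m})"
  proof (intro equalityI subsetI)
    fix i assume i: "i \<in> {1..Suc m}"
    show "i \<in> insert j (?g ` {1..m})"
    proof (cases "i < j")
      case True
      then show ?thesis using i j by (intro insertI2 image_eqI[where x = i]) auto
    next
      case False
      show ?thesis
      proof (cases "i = j")
        case False
        with \<open>\<not> i < j\<close> show ?thesis using i j by (intro insertI2 image_eqI[where x = "i - 1"]) auto
      qed simp
    qed
  qed (use j in auto)
  have jg: "j \<noteq> ?g i" for i by auto
  have lr: "{i \<in> {1..Suc m}. \<forall>k\<in>{1..<i}. ?\<sigma> i < ?\<sigma> k} =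
      ?g ` {i \<in> {1..m}. \<forall>k\<in>{1..<i}. \<tau> i < \<tau> k} \<union> (if j = 1 then {j} else {})" (is "?A = ?B")
  proof (rule set_eqI)
    fix i
    consider "i \<notin> {1..Suc m}" | "i = j" | l where "l \<in> {1..m}" "i = ?g l" using cover by blast
    then show "i \<in> ?A \<longleftrightarrow> i \<in> ?B"
    proof cases
      case 1
      then show ?thesis using j by auto
    next
      case 2
      \<comment> \<open>Position 1 rules out \<open>j\<close> as a left-to-right minimum as soon as
        \<open>j\<close> is not first.\<close>
      have "\<not> ?\<sigma> j < ?\<sigma> 1" using new ap[of 1] le[of 1] m j by auto
      then show ?thesis using 2 j jg by (auto simp: Bex_def image_iff)
    next
      case (3 l)
      \<comment> \<open>A possible extra comparison with position \<open>j\<close> succeeds, since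
        the letter there is \<open>Suc m\<close>.\<close>
      have "(\<forall>k\<in>{1..<?g l}. \<tau> l < ?\<sigma> k) \<longleftrightarrow> (\<forall>k\<in>{1..<l}. \<tau> l < \<tau> k)"
      proof (intro iffI ballI)
        fix k assume "\<forall>k\<in>{1..<?g l}. \<tau> l < ?\<sigma> k" "k \<in> {1..<l}"
        moreover from this have "?g k \<in> {1..<?g l}" by auto
        ultimately have "\<tau> l < ?\<sigma> (?g k)" "k \<in> {1..m}" using 3(1) by auto
        then show "\<tau> l < \<tau> k" using old[of k] by simp
      next
        fix k assume k: "\<forall>k\<in>{1..<l}. \<tau> l < \<tau> k" "k \<in> {1..<?g l}"
        then have "k \<in> {1..Suc m}" using 3 by (auto split: if_splits)
        then consider "k = j" | k' where "k' \<in> {1..m}" "k = ?g k'" using cover by blast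
        then show "\<tau> l < ?\<sigma> k"
        proof cases
          case 1
          then show ?thesis using new le[OF 3(1)] by simp
        next
          case (2 k')
          then have "k' \<in> {1..<l}" using k(2) less[of k' l] by auto
          then show ?thesis using 2 k(1) old[of k'] by simp
        qed
      qed
      moreover have "i \<in> {1..Suc m}" "?\<sigma> i = \<tau> l" using 3 old by auto
      moreover have "i \<in> ?B \<longleftrightarrow> l \<in> {i \<in> {1..m}. \<forall>k\<in>{1..<i}. \<tau> i < \<tau> k}"
        using 3 jg[of l] inj_on_image_mem_iff[OF inj[of UNIV]] by (auto simp del: o_apply split: if_splits)
      ultimately show ?thesis using 3 by (simp del: o_apply)
    qed
  qed
  have rl: "{i \<in> {1..Suc m}. \<forall>k\<in>{i<..Suc m}. ?\<sigma> i < ?\<sigma> k} =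
      ?g ` {i \<in> {1..m}. \<forall>k\<in>{i<..m}. \<tau> i < \<tau> k} \<union> (if j = Suc m then {j} else {})" (is "?A = ?B")
  proof (rule set_eqI)
    fix i
    consider "i \<notin> {1..Suc m}" | "i = j" | l where "l \<in> {1..m}" "i = ?g l" using cover by blast
    then show "i \<in> ?A \<longleftrightarrow> i \<in> ?B"
    proof cases
      case 1
      then show ?thesis using j by auto
    next
      case 2
      have "\<not> ?\<sigma> j < ?\<sigma> (Suc m)" using new ap[of "Suc m"] le[of m] m j by auto
      then show ?thesis using 2 j jg by (auto simp: Bex_def image_iff simp del: o_apply intro!: exI[of _ "Suc m"])
    next
      case (3 l)
      have "(\<forall>k\<in>{?g l<..Suc m}. \<tau> l < ?\<sigma> k) \<longleftrightarrow> (\<forall>k\<in>{l<..m}. \<tau> l < \<tau> k)"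
      proof (intro iffI ballI)
        fix k assume "\<forall>k\<in>{?g l<..Suc m}. \<tau> l < ?\<sigma> k" "k \<in> {l<..m}"
        moreover from this have "?g k \<in> {?g l<..Suc m}" by auto
        ultimately have "\<tau> l < ?\<sigma> (?g k)" "k \<in> {1..m}" using 3(1) by auto
        then show "\<tau> l < \<tau> k" using old[of k] by simp
      next
        fix k assume k: "\<forall>k\<in>{l<..m}. \<tau> l < \<tau> k" "k \<in> {?g l<..Suc m}"
        then have "k \<in> {1..Suc m}" using 3 by (auto split: if_splits)
        then consider "k = j" | k' where "k' \<in> {1..m}" "k = ?g k'" using cover by blast
        then show "\<tau> l < ?\<sigma> k"
        proof cases
          case 1
          then show ?thesis using new le[OF 3(1)] by simp
        next
          case (2 k')
          then have "k' \<in> {l<..m}" using k(2) less[of l k'] by auto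
          then show ?thesis using 2 k(1) old[of k'] by simp
        qed
      qed
      moreover have "i \<in> {1..Suc m}" "?\<sigma> i = \<tau> l" using 3 old by auto
      moreover have "i \<in> ?B \<longleftrightarrow> l \<in> {i \<in> {1..m}. \<forall>k\<in>{i<..m}. \<tau> i < \<tau> k}"
        using 3 jg[of l] inj_on_image_mem_iff[OF inj[of UNIV]] by (auto simp del: o_apply split: if_splits)
      ultimately show ?thesis using 3 by (simp del: o_apply)
    qed
  qed
  have card: "card (?g ` A \<union> (if b then {j} else {})) = card A + of_bool b" if "finite A" for A b
  proof -
    have "j \<notin> ?g ` A" using jg by blast
    then show ?thesis using that card_image[OF inj, of A] by auto
  qed
  show "lrmin (Suc m) ?\<sigma> = lrmin m \<tau> + of_bool (j = 1)"
    unfolding lrmin_def lr by (rule card) simp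
  show "rlmin (Suc m) ?\<sigma> = rlmin m \<tau> + of_bool (j = Suc m)"
    unfolding rlmin_def rl by (rule card) simp
qed

text \<open>The first and the last position always qualify. Hence subtracting 2 is never truncated,
  and a new minimum raises the exponent of \<alpha> by exactly one.\<close>

lemma lrmin_rlmin_pos:
  assumes "1 \<le> m"
  shows "1 \<le> lrmin m \<sigma>" "1 \<le> rlmin m \<sigma>"
proof -
  have "card {1 :: nat} \<le> lrmin m \<sigma>"
    unfolding lrmin_def by (rule card_mono) (use assms in auto)
  then show "1 \<le> lrmin m \<sigma>" by simp
  have "card {m} \<le> rlmin m \<sigma>"
    unfolding rlmin_def by (rule card_mono) (use assms in auto)
  then show "1 \<le> rlmin m \<sigma>" by simp
qed

text \<open>The two end slots give the \<alpha> terms of \<open>insertion_op\<close>, the interior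
  slots the two counted terms.\<close>

lemma sum_permutations_insert:
  fixes f :: "nat \<Rightarrow> nat \<Rightarrow> 'a::comm_ring_1"
  assumes m: "1 \<le> m"
  shows "(\<Sum>\<sigma> | \<sigma> permutes {1..Suc m}.
      \<alpha> ^ (lrmin (Suc m) \<sigma> + rlmin (Suc m) \<sigma> - 2) * f (des (Suc m) \<sigma>) (asc (Suc m) \<sigma>)) =
    (\<Sum>\<tau> | \<tau> permutes {1..m}.
      \<alpha> ^ (lrmin m \<tau> + rlmin m \<tau> - 2) * insertion_op \<alpha> f (des m \<tau>) (asc m \<tau>))"
  unfolding sum_permutes_Suc
proof (intro sum.cong refl)
  fix \<tau> :: "nat \<Rightarrow> nat" assume "\<tau> \<in> {\<tau>. \<tau> permutes {1..m}}"
  then have \<tau>: "\<tau> permutes {1..m}" by simp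
  let ?w = "\<alpha> ^ (lrmin m \<tau> + rlmin m \<tau> - 2)" and ?d = "des m \<tau>" and ?a = "asc m \<tau>"
  let ?h = "\<lambda>\<sigma>. \<alpha> ^ (lrmin (Suc m) \<sigma> + rlmin (Suc m) \<sigma> - 2) * f (des (Suc m) \<sigma>) (asc (Suc m) \<sigma>)"
  note stats = lrmin_rlmin_insert[OF \<tau> _ m] asc_insert[OF \<tau>] des_insert[OF \<tau>]
  note pos = lrmin_rlmin_pos[OF m, of \<tau>]
  note split = ascents_Un_descents[OF \<tau>]
  \<comment> \<open>For the end slots the removed index \<open>j - 1\<close> is 0 or
    \<open>m\<close>, where no adjacent pair starts.\<close>
  have zero: "ascents m \<tau> - {0} = ascents m \<tau>" "descents m \<tau> - {0} = descents m \<tau>"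
      "ascents m \<tau> - {m} = ascents m \<tau>" "descents m \<tau> - {m} = descents m \<tau>"
    by (auto simp: ascents_def descents_def)
  have front: "?h (\<tau> \<circ> slot_perm m 1) = \<alpha> * ?w * f (Suc ?d) ?a"
  proof -
    have "lrmin m \<tau> + 1 + rlmin m \<tau> - 2 = Suc (lrmin m \<tau> + rlmin m \<tau> - 2)" using pos by simp
    then show ?thesis using m by (simp add: stats zero asc_eq_card[of m] des_eq_card[of m] del: o_apply)
  qed
  have end_slot: "?h (\<tau> \<circ> slot_perm m (Suc m)) = \<alpha> * ?w * f ?d (Suc ?a)"
  proof -
    have "lrmin m \<tau> + (rlmin m \<tau> + 1) - 2 = Suc (lrmin m \<tau> + rlmin m \<tau> - 2)" using pos by simp
    then show ?thesis using m by (simp add: stats zero asc_eq_card[of m] des_eq_card[of m] del: o_apply)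
  qed
  \<comment> \<open>The filled ascent is lost and the new letter brings an ascent and a descent: the
    net gain is one descent.\<close>
  have up: "?h (\<tau> \<circ> slot_perm m (Suc i)) = ?w * f (Suc ?d) ?a" if i: "i \<in> ascents m \<tau>" for i
  proof -
    have "i \<notin> descents m \<tau>" "1 \<le> i" "i < m" using i split by auto
    moreover have "Suc (card (ascents m \<tau> - {i})) = card (ascents m \<tau>)"
      using i by (intro card_Suc_Diff1) auto
    ultimately show ?thesis
      using i by (simp add: stats asc_eq_card[of m] des_eq_card[of m] del: o_apply card_Diff_insert)
  qed
  have down: "?h (\<tau> \<circ> slot_perm m (Suc i)) = ?w * f ?d (Suc ?a)" if i: "i \<in> descents m \<tau>" for i
  proof -
    have "i \<notin> ascents m \<tau>" "1 \<le> i" "i < m" using i split by auto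
    moreover have "Suc (card (descents m \<tau> - {i})) = card (descents m \<tau>)"
      using i by (intro card_Suc_Diff1) auto
    ultimately show ?thesis
      using i by (simp add: stats asc_eq_card[of m] des_eq_card[of m] del: o_apply card_Diff_insert)
  qed
  \<comment> \<open>Slot \<open>Suc i\<close> lies between positions \<open>i\<close> and
    \<open>i + 1\<close>; slots 1 and \<open>Suc m\<close> are the ends.\<close>
  have "{1..Suc m} = insert 1 (insert (Suc m) (Suc ` {1..<m}))"
    using m by auto
  then have "(\<Sum>j\<in>{1..Suc m}. ?h (\<tau> \<circ> slot_perm m j)) =
      ?h (\<tau> \<circ> slot_perm m 1) + (?h (\<tau> \<circ> slot_perm m (Suc m)) + (\<Sum>j\<in>Suc ` {1..<m}. ?h (\<tau> \<circ> slot_perm m j)))"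
    using m by (simp del: o_apply)
  also have "(\<Sum>j\<in>Suc ` {1..<m}. ?h (\<tau> \<circ> slot_perm m j)) =
      (\<Sum>i\<in>ascents m \<tau> \<union> descents m \<tau>. ?h (\<tau> \<circ> slot_perm m (Suc i)))"
    unfolding split(1) by (rule sum.reindex_cong[where l = Suc]) auto
  also have "\<dots> =
      (\<Sum>i\<in>ascents m \<tau>. ?h (\<tau> \<circ> slot_perm m (Suc i))) + (\<Sum>i\<in>descents m \<tau>. ?h (\<tau> \<circ> slot_perm m (Suc i)))"
    by (rule sum.union_disjoint) (simp_all add: split(2))
  also have "\<dots> = of_nat ?a * (?w * f (Suc ?d) ?a) + of_nat ?d * (?w * f ?d (Suc ?a))"
    using up down by (simp add: asc_eq_card[of m] des_eq_card[of m] del: o_apply)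
  finally have eq: "(\<Sum>j\<in>{1..Suc m}. ?h (\<tau> \<circ> slot_perm m j)) = \<alpha> * ?w * f (Suc ?d) ?a +
      (\<alpha> * ?w * f ?d (Suc ?a) + (of_nat ?a * (?w * f (Suc ?d) ?a) + of_nat ?d * (?w * f ?d (Suc ?a))))"
    unfolding front end_slot .
  show "(\<Sum>j\<in>{1..Suc m}. ?h (\<tau> \<circ> slot_perm m j)) = ?w * insertion_op \<alpha> f ?d ?a"
    unfolding eq insertion_op_def by (simp add: algebra_simps)
qed

section \<open>Attaching the largest label to a tree\<close>

text \<open>All ways to hang a new leaf \<open>z\<close> below a vertex with fewer than two
  children. A list lets sums follow the recursion; \<open>grow_distinct\<close> allows the passage
  to sets.\<close>

fun grow :: "'v \<Rightarrow> 'v tree012 \<Rightarrow> 'v tree012 list" where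
  "grow z (Leaf v) = [Unary v (Leaf z)]"
| "grow z (Unary v t) = Binary v t (Leaf z) # Binary v (Leaf z) t # map (Unary v) (grow z t)"
| "grow z (Binary v l r) = map (\<lambda>l'. Binary v l' r) (grow z l) @ map (Binary v l) (grow z r)"

text \<open>Deletes the leaf \<open>z\<close>; a sibling left behind becomes a sole child. A tree
  cannot become empty, so \<open>Leaf z\<close> is left unchanged and has to be excluded in the
  lemmas on labels and on regrowing.\<close>

fun prune :: "'v \<Rightarrow> 'v tree012 \<Rightarrow> 'v tree012" where
  "prune z (Leaf v) = Leaf v"
| "prune z (Unary v t) = (if t = Leaf z then Leaf v else Unary v (prune z t))"
| "prune z (Binary v l r) =
     (if l = Leaf z then Unary v r else if r = Leaf z then Unary v l
      else Binary v (prune z l) (prune z r))"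

lemma tree_root_in_labels: "tree_root t \<in> set (vertex_labels t)"
  by (cases t) auto

lemma prune_id: "z \<notin> set (vertex_labels t) \<Longrightarrow> prune z t = t"
  by (induction t) auto

lemma grow_labels: "s \<in> set (grow z t) \<Longrightarrow> set (vertex_labels s) = insert z (set (vertex_labels t))"
  by (induction t arbitrary: s) auto

lemma grow_root: "s \<in> set (grow z t) \<Longrightarrow> tree_root s = tree_root t"
  by (cases t) auto

lemma grow_not_Leaf: "Leaf v \<notin> set (grow z t)"
  by (cases t) auto

lemma grow_distinct_labels:
  "s \<in> set (grow z t) \<Longrightarrow> z \<notin> set (vertex_labels t) \<Longrightarrow> distinct (vertex_labels t) \<Longrightarrow>
    distinct (vertex_labels s)"
  by (induction t arbitrary: s) (auto simp: grow_labels)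

lemma grow_increasing:
  "s \<in> set (grow z t) \<Longrightarrow> \<forall>v\<in>set (vertex_labels t). v < z \<Longrightarrow> increasing t \<Longrightarrow> increasing s"
  by (induction t arbitrary: s) (auto simp: grow_root)

text \<open>The tests for \<open>Leaf z\<close> succeed only at the attached leaf: a grown subtree
  is never a single leaf, and the other subtrees do not contain \<open>z\<close>.\<close>

lemma prune_grow:
  "s \<in> set (grow z t) \<Longrightarrow> z \<notin> set (vertex_labels t) \<Longrightarrow> prune z s = t"
  by (induction t arbitrary: s) (auto simp: grow_not_Leaf prune_id)

text \<open>Trees grown in the left and in the right subtree differ because \<open>z\<close> lies on
  different sides.\<close>

lemma grow_distinct: "z \<notin> set (vertex_labels t) \<Longrightarrow> distinct (grow z t)"
proof (induction t)
  case (Binary v l r)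
  then show ?case
    by (auto simp: distinct_map inj_on_def dest: grow_labels)
qed (auto simp: distinct_map inj_on_def)

lemma prune_root: "t \<noteq> Leaf z \<Longrightarrow> tree_root (prune z t) = tree_root t"
  by (cases t) auto

lemma prune_increasing: "increasing t \<Longrightarrow> increasing (prune z t)"
  by (induction t) (auto simp: prune_root)

lemma prune_labels_subset: "set (vertex_labels (prune z t)) \<subseteq> set (vertex_labels t)"
  by (induction t) auto

lemma prune_distinct_labels: "distinct (vertex_labels t) \<Longrightarrow> distinct (vertex_labels (prune z t))"
proof (induction t)
  case (Unary v t)
  then show ?case using prune_labels_subset[of z t] by auto
next
  case (Binary v l r)
  then show ?case using prune_labels_subset[of z l] prune_labels_subset[of z r] by auto
qed auto

text \<open>A vertex with children is smaller than them, hence smaller than the maximum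
  \<open>z\<close>. So \<open>z\<close> can only label a leaf, which \<open>prune\<close>
  removes.\<close>

lemma prune_labels:
  assumes "distinct (vertex_labels t)" "increasing t" "\<forall>v\<in>set (vertex_labels t). v \<le> z" "t \<noteq> Leaf z"
  shows "set (vertex_labels (prune z t)) = set (vertex_labels t) - {z}"
  using assms
proof (induction t)
  case (Unary v t)
  then show ?case using tree_root_in_labels[of t] by auto
next
  case (Binary v l r)
  have "v < tree_root l" "tree_root l \<le> z" using Binary.prems tree_root_in_labels[of l] by auto
  then have "v < z" by (rule order.strict_trans2)
  then show ?case using Binary by auto
qed auto

lemma grow_prune:
  assumes "distinct (vertex_labels t)" "increasing t" "\<forall>v\<in>set (vertex_labels t). v \<le> z" "t \<noteq> Leaf z"
    "z \<in> set (vertex_labels t)"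
  shows "t \<in> set (grow z (prune z t))"
  using assms
proof (induction t)
  case (Unary v t)
  then show ?case using tree_root_in_labels[of t] by auto
next
  case (Binary v l r)
  have "v < tree_root l" "tree_root l \<le> z" using Binary.prems tree_root_in_labels[of l] by auto
  then have "v < z" by (rule order.strict_trans2)
  \<comment> \<open>By distinctness \<open>z\<close> lies in exactly one subtree;
    \<open>prune\<close> leaves the other one alone.\<close>
  with Binary.prems have "z \<in> set (vertex_labels l) \<and> z \<notin> set (vertex_labels r) \<or>
      z \<in> set (vertex_labels r) \<and> z \<notin> set (vertex_labels l)" by auto
  then show ?case using Binary by (auto simp: prune_id)
qed auto

section \<open>Exponents of x + y and x y in the weight of a tree\<close>

fun linear_count :: "'v tree012 \<Rightarrow> nat" where
  "linear_count (Leaf v) = 0"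
| "linear_count (Unary v t) = Suc (linear_count t)"
| "linear_count (Binary v l r) = linear_count l + linear_count r"

fun leaf_count :: "'v tree012 \<Rightarrow> nat" where
  "leaf_count (Leaf v) = 1"
| "leaf_count (Unary v t) = leaf_count t"
| "leaf_count (Binary v l r) = leaf_count l + leaf_count r"

lemma tree_weight_eq: "tree_weight x y t = (x + y) ^ linear_count t * (x * y) ^ leaf_count t"
  by (induction t) (auto simp: power_add algebra_simps)

text \<open>Each one-child vertex takes the leaf on two sides, ceasing to be linear; each leaf
  becomes linear above the new leaf. Arbitrary \<open>g\<close> lets the induction absorb the rest
  of the tree as a shift of arguments.\<close>

lemma sum_grow:
  fixes g :: "nat \<Rightarrow> nat \<Rightarrow> 'a::comm_ring_1"
  shows "(\<Sum>s\<leftarrow>grow z t. g (linear_count s) (leaf_count s)) =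
    2 * of_nat (linear_count t) * g (linear_count t - 1) (Suc (leaf_count t)) +
    of_nat (leaf_count t) * g (Suc (linear_count t)) (leaf_count t)"
proof (induction t arbitrary: g)
  case (Unary v t)
  show ?case using Unary[of "\<lambda>p. g (Suc p)"]
    by (cases "linear_count t") (simp_all add: o_def algebra_simps)
next
  case (Binary v l r)
  show ?case
    using Binary(1)[of "\<lambda>p q. g (p + linear_count r) (q + leaf_count r)"]
      Binary(2)[of "\<lambda>p q. g (linear_count l + p) (leaf_count l + q)"]
    by (cases "linear_count l"; cases "linear_count r") (simp_all add: o_def algebra_simps)
qed auto

section \<open>Growing and pruning planted trees\<close>

fun planted_grow :: "'v \<Rightarrow> 'v planted \<Rightarrow> 'v planted list" where
  "planted_grow z (SingleRoot v) = [PlantedRoot v (Leaf z)]"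
| "planted_grow z (PlantedRoot v t) = map (PlantedRoot v) (grow z t)"

fun planted_prune :: "'v \<Rightarrow> 'v planted \<Rightarrow> 'v planted" where
  "planted_prune z (SingleRoot v) = SingleRoot v"
| "planted_prune z (PlantedRoot v t) =
     (if t = Leaf z then SingleRoot v else PlantedRoot v (prune z t))"

abbreviation planted_tree :: "'v::linorder planted \<Rightarrow> bool" where
  "planted_tree T \<equiv> planted_increasing_tree_on (planted_labels T) T"

text \<open>Replaces the minimum by comparisons, the form that growing and pruning preserve
  visibly.\<close>

lemma planted_tree_PlantedRoot:
  "planted_tree (PlantedRoot v t) \<longleftrightarrow>
     (\<forall>w\<in>set (vertex_labels t). v < w) \<and> distinct (vertex_labels t) \<and> increasing t"
proof -
  have "v = Min (insert v (set (vertex_labels t))) \<longleftrightarrow> (\<forall>w\<in>set (vertex_labels t). v \<le> w)"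
    by (metis (no_types, lifting) List.finite_set Min_eqI Min_le finite_insert insertE insertI1 insertI2 order_refl)
  moreover have "insert v (set (vertex_labels t)) - {v} = set (vertex_labels t) \<longleftrightarrow> v \<notin> set (vertex_labels t)"
    by auto
  ultimately show ?thesis
    by (auto simp: increasing_tree_on_def order_less_le)
qed

declare planted_increasing_tree_on.simps [simp del]

lemma planted_tree_SingleRoot: "planted_tree (SingleRoot v)"
  by (simp add: planted_increasing_tree_on.simps)

lemmas planted_tree_simps = planted_tree_SingleRoot planted_tree_PlantedRoot

lemma planted_labels_nonempty [simp]: "planted_labels T \<noteq> {}"
  by (cases T) auto

lemma planted_grow_labels:
  "S \<in> set (planted_grow z T) \<Longrightarrow> planted_labels S = insert z (planted_labels T)"
  by (cases T) (auto dest: grow_labels)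

lemma planted_grow_tree:
  assumes "S \<in> set (planted_grow z T)" "planted_tree T" "\<forall>v\<in>planted_labels T. v < z"
  shows "planted_tree S"
proof (cases T)
  case (PlantedRoot v t)
  then obtain s where s: "S = PlantedRoot v s" "s \<in> set (grow z t)"
    using assms by auto
  have "z \<notin> set (vertex_labels t)" using assms PlantedRoot by auto
  then show ?thesis
    using assms PlantedRoot s grow_labels[OF s(2)] grow_distinct_labels[OF s(2)] grow_increasing[OF s(2)]
    by (auto simp: planted_tree_PlantedRoot simp del: planted_labels.simps) auto
qed (use assms in \<open>auto simp: planted_tree_PlantedRoot simp del: planted_labels.simps(2)\<close>)

lemma planted_prune_grow:
  "S \<in> set (planted_grow z T) \<Longrightarrow> z \<notin> planted_labels T \<Longrightarrow> planted_prune z S = T"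
  by (cases T) (auto simp: prune_grow grow_not_Leaf)

lemma planted_grow_distinct: "z \<notin> planted_labels T \<Longrightarrow> distinct (planted_grow z T)"
  by (cases T) (auto simp: distinct_map inj_on_def grow_distinct)

text \<open>The planted root is smaller than its child and so differs from \<open>z\<close>. Thus
  \<open>z\<close> lies in the tree above it, and the sole-child case \<open>Leaf z\<close> is now a
  genuine deletion.\<close>

lemma planted_prune:
  assumes "planted_tree T" "\<forall>v\<in>planted_labels T. v \<le> z" "T \<noteq> SingleRoot z" "z \<in> planted_labels T"
  shows "planted_tree (planted_prune z T)" "planted_labels (planted_prune z T) = planted_labels T - {z}"
    "T \<in> set (planted_grow z (planted_prune z T))"
proof -
  obtain v t where T: "T = PlantedRoot v t" using assms(3,4) by (cases T) auto
  have t: "\<forall>w\<in>set (vertex_labels t). v < w" "distinct (vertex_labels t)" "increasing t"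
      "\<forall>v\<in>set (vertex_labels t). v \<le> z"
    using assms T by (auto simp: planted_tree_PlantedRoot simp del: planted_labels.simps) auto
  have vz: "v < z" using t tree_root_in_labels[of t] by fastforce
  then have z: "z \<in> set (vertex_labels t)" using assms T by auto
  show "planted_tree (planted_prune z T)"
    using T t prune_labels_subset[of z t]
    by (auto simp: planted_tree_simps prune_distinct_labels prune_increasing simp del: planted_labels.simps)
  show "planted_labels (planted_prune z T) = planted_labels T - {z}"
    using T t vz prune_labels[of t z] by auto
  show "T \<in> set (planted_grow z (planted_prune z T))"
    using T t z grow_prune[of t z] by auto
qed

section \<open>Weights of planted trees\<close>

fun planted_coeff :: "'a::comm_ring_1 \<Rightarrow> 'v planted \<Rightarrow> 'a" where
  "planted_coeff \<alpha> (SingleRoot v) = \<alpha>"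
| "planted_coeff \<alpha> (PlantedRoot v t) = 2 * \<alpha>"

text \<open>A single root counts as linear because its weight contains x + y.\<close>

fun planted_linear :: "'v planted \<Rightarrow> nat" where
  "planted_linear (SingleRoot v) = 1"
| "planted_linear (PlantedRoot v t) = linear_count t"

fun planted_leaves :: "'v planted \<Rightarrow> nat" where
  "planted_leaves (SingleRoot v) = 0"
| "planted_leaves (PlantedRoot v t) = leaf_count t"

lemma planted_weight_eq:
  "planted_weight x y \<alpha> T = planted_coeff \<alpha> T * ((x + y) ^ planted_linear T * (x * y) ^ planted_leaves T)"
  by (cases T) (auto simp: tree_weight_eq)

text \<open>A single root grows in only one way, but its coefficient passes from \<alpha> to 2
  \<alpha>; so it obeys the formula for linear vertices with their two sides.\<close>

lemma sum_planted_grow: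
  fixes g :: "nat \<Rightarrow> nat \<Rightarrow> 'a::comm_ring_1"
  assumes "z \<notin> planted_labels T"
  shows "(\<Sum>S\<in>set (planted_grow z T). planted_coeff \<alpha> S * g (planted_linear S) (planted_leaves S)) =
    planted_coeff \<alpha> T *
     (2 * of_nat (planted_linear T) * g (planted_linear T - 1) (Suc (planted_leaves T)) +
      of_nat (planted_leaves T) * g (Suc (planted_linear T)) (planted_leaves T))"
proof -
  have "(\<Sum>S\<in>set (planted_grow z T). planted_coeff \<alpha> S * g (planted_linear S) (planted_leaves S)) =
      (\<Sum>S\<leftarrow>planted_grow z T. planted_coeff \<alpha> S * g (planted_linear S) (planted_leaves S))"
    by (simp add: sum_list_distinct_conv_sum_set planted_grow_distinct[OF assms])
  then show ?thesis
    by (cases T) (simp_all add: o_def sum_list_const_mult sum_grow)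
qed

text \<open>Label sets are nonempty, so pairwise disjointness over the trees already forces
  injectivity. In this form trees can be added and removed easily.\<close>

lemma forest_on_iff:
  "forest_on N F \<longleftrightarrow>
     (\<forall>T\<in>F. planted_tree T) \<and> disjoint_family_on planted_labels F \<and> \<Union> (planted_labels ` F) = N"
proof -
  have "disjoint_family_on planted_labels F" if "inj_on planted_labels F" "disjoint (planted_labels ` F)"
    using that unfolding disjoint_family_on_def disjoint_def inj_on_def by blast
  moreover have "inj_on planted_labels F" "disjoint (planted_labels ` F)" if d: "disjoint_family_on planted_labels F"
  proof -
    show "inj_on planted_labels F"
    proof (rule inj_onI, rule ccontr)
      fix S T assume "S \<in> F" "T \<in> F" "planted_labels S = planted_labels T" "S \<noteq> T"
      then show False using disjoint_family_onD[OF d] planted_labels_nonempty by (metis Int_absorb)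
    qed
    show "disjoint (planted_labels ` F)" by (rule disjoint_family_on_disjoint_image[OF d])
  qed
  moreover have "{} \<notin> planted_labels ` F" by (metis imageE planted_labels_nonempty)
  ultimately show ?thesis unfolding forest_on_def partition_on_def by blast
qed

section \<open>Attaching the largest label to a forest\<close>

lemma forest_on_insert:
  assumes "forest_on N F" "planted_tree T" "planted_labels T \<inter> N = {}"
  shows "forest_on (N \<union> planted_labels T) (insert T F)"
  using assms unfolding forest_on_iff disjoint_family_on_def by auto

lemma forest_on_remove:
  assumes "forest_on N F" "T \<in> F"
  shows "forest_on (N - planted_labels T) (F - {T})"
  using assms unfolding forest_on_iff disjoint_family_on_def by auto

lemma forest_on_labels_subset: "forest_on N F \<Longrightarrow> T \<in> F \<Longrightarrow> planted_labels T \<subseteq> N"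
  by (auto simp: forest_on_iff)

lemma forest_on_tree: "forest_on N F \<Longrightarrow> T \<in> F \<Longrightarrow> planted_tree T"
  by (auto simp: forest_on_iff)

lemma forest_on_unique:
  "forest_on N F \<Longrightarrow> S \<in> F \<Longrightarrow> T \<in> F \<Longrightarrow> z \<in> planted_labels S \<Longrightarrow> z \<in> planted_labels T \<Longrightarrow> S = T"
  by (auto simp: forest_on_iff disjoint_family_on_def)

lemma forest_on_finite:
  assumes "forest_on N F" "finite N"
  shows "finite F"
  using assms finite_elements[of N "planted_labels ` F"] finite_imageD
  unfolding forest_on_def by blast

lemma forest_on_grow:
  assumes F: "forest_on N F" and T: "T \<in> F" and S: "S \<in> set (planted_grow z T)" and z: "\<forall>v\<in>N. v < z"
  shows "forest_on (insert z N) (insert S (F - {T}))"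
proof -
  have "planted_tree S"
    by (rule planted_grow_tree[OF S forest_on_tree[OF F T]]) (use forest_on_labels_subset[OF F T] z in blast)
  then have "forest_on ((N - planted_labels T) \<union> planted_labels S) (insert S (F - {T}))"
    using planted_grow_labels[OF S] z by (intro forest_on_insert forest_on_remove F T) auto
  also have "(N - planted_labels T) \<union> planted_labels S = insert z N"
    using planted_grow_labels[OF S] forest_on_labels_subset[OF F T] by auto
  finally show ?thesis .
qed

text \<open>The tree containing \<open>z\<close> is either the single root \<open>z\<close> or
  arises by growing exactly one tree of a forest on \<open>N\<close>.\<close>

lemma sum_forest_on_insert:
  fixes h :: "'v::linorder planted set \<Rightarrow> 'a::comm_ring_1"
  assumes N: "finite N" and z: "\<forall>v\<in>N. v < z"
  shows "(\<Sum>F | forest_on (insert z N) F. h F) =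
    (\<Sum>F | forest_on N F. h (insert (SingleRoot z) F) +
       (\<Sum>T\<in>F. \<Sum>S\<in>set (planted_grow z T). h (insert S (F - {T}))))"
proof -
  let ?R = "SingleRoot z"
  have zN: "z \<notin> N" using z by auto
  have fin: "finite {F. forest_on N F}" "finite {F. forest_on (insert z N) F}"
    using N by (auto intro: finite_forests_on)
  have split: "{F. forest_on (insert z N) F} =
      {F. forest_on (insert z N) F \<and> ?R \<in> F} \<union> {F. forest_on (insert z N) F \<and> ?R \<notin> F}" by auto
  have "(\<Sum>F | forest_on (insert z N) F. h F) =
      (\<Sum>F | forest_on (insert z N) F \<and> ?R \<in> F. h F) + (\<Sum>F | forest_on (insert z N) F \<and> ?R \<notin> F. h F)"
    unfolding split by (rule sum.union_disjoint) (auto intro: finite_subset[OF _ fin(2)])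
  also have "(\<Sum>F | forest_on (insert z N) F \<and> ?R \<in> F. h F) = (\<Sum>F | forest_on N F. h (insert ?R F))"
  proof (rule sum.reindex_bij_witness[where i = "insert ?R" and j = "\<lambda>F. F - {?R}"])
    fix F assume "F \<in> {F. forest_on (insert z N) F \<and> ?R \<in> F}"
    then show "F - {?R} \<in> {F. forest_on N F}"
      using forest_on_remove[of "insert z N" F ?R] zN by auto
  next
    fix F assume F: "F \<in> {F. forest_on N F}"
    then show "insert ?R F \<in> {F. forest_on (insert z N) F \<and> ?R \<in> F}"
      using forest_on_insert[of N F ?R] zN by (auto simp: planted_increasing_tree_on.simps)
    have "?R \<notin> F" using F forest_on_labels_subset[of N F ?R] zN by auto
    then show "insert ?R F - {?R} = F" by simp
  qed (auto simp: insert_absorb)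
  also have "(\<Sum>F | forest_on (insert z N) F \<and> ?R \<notin> F. h F) =
      (\<Sum>(F, T, S)\<in>(SIGMA F:{F. forest_on N F}. SIGMA T:F. set (planted_grow z T)). h (insert S (F - {T})))"
  proof -
    \<comment> \<open>The tree carrying \<open>z\<close>, unique because label sets are
      disjoint.\<close>
    define holder where "holder F = (THE S. S \<in> F \<and> z \<in> planted_labels S)" for F
    have holder_eq: "holder F = S" if "forest_on (insert z N) F" "S \<in> F" "z \<in> planted_labels S" for F S
      unfolding holder_def by (rule the_equality) (use that forest_on_unique in blast)+
    have holder: "holder F \<in> F" "z \<in> planted_labels (holder F)" if F: "forest_on (insert z N) F" for F
    proof -
      have "z \<in> \<Union> (planted_labels ` F)" using F by (simp add: forest_on_iff)
      then obtain S where "S \<in> F" "z \<in> planted_labels S" by blast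
      then show "holder F \<in> F" "z \<in> planted_labels (holder F)" using holder_eq[OF F] by auto
    qed
    show ?thesis
    proof (rule sum.reindex_bij_witness[where
          i = "\<lambda>(F, T, S). insert S (F - {T})" and
          j = "\<lambda>F. (insert (planted_prune z (holder F)) (F - {holder F}), planted_prune z (holder F), holder F)"])
      fix F assume "F \<in> {F. forest_on (insert z N) F \<and> ?R \<notin> F}"
      then have F: "forest_on (insert z N) F" "?R \<notin> F" by auto
      let ?S = "holder F"
      note S = holder[OF F(1)]
      let ?T = "planted_prune z ?S"
      have sub: "planted_labels ?S \<subseteq> insert z N" by (rule forest_on_labels_subset[OF F(1) S(1)])
      have "\<forall>v\<in>planted_labels ?S. v \<le> z" using sub z by force
      note T = planted_prune[OF forest_on_tree[OF F(1) S(1)] this _ S(2)]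
      have "?S \<noteq> ?R" using F S by metis
      note T = T[OF this]
      have "forest_on ((insert z N - planted_labels ?S) \<union> planted_labels ?T) (insert ?T (F - {?S}))"
        using T by (intro forest_on_insert forest_on_remove F S) auto
      also have "(insert z N - planted_labels ?S) \<union> planted_labels ?T = N"
        unfolding T(2) using sub S zN by auto
      finally have "forest_on N (insert ?T (F - {?S}))" .
      then show "(insert ?T (F - {?S}), ?T, ?S) \<in> (SIGMA F:{F. forest_on N F}. SIGMA T:F. set (planted_grow z T))"
        using T by simp
      \<comment> \<open>Otherwise taking \<open>?T\<close> out again would lose an original tree; it
        would share a label with \<open>?S\<close>.\<close>
      have "?T \<notin> F - {?S}"
      proof
        assume "?T \<in> F - {?S}"
        moreover obtain v where "v \<in> planted_labels ?T" using planted_labels_nonempty[of ?T] by blast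
        ultimately show False using forest_on_unique[OF F(1) _ S(1), of ?T v] T(2) by auto
      qed
      then show "(case (insert ?T (F - {?S}), ?T, ?S) of (F, T, S) \<Rightarrow> insert S (F - {T})) = F"
        using S by auto
      then show "(case (insert ?T (F - {?S}), ?T, ?S) of (F, T, S) \<Rightarrow> h (insert S (F - {T}))) = h F"
        by simp
    next
      fix p assume p: "p \<in> (SIGMA F:{F. forest_on N F}. SIGMA T:F. set (planted_grow z T))"
      obtain F T S where p_eq: "p = (F, T, S)" by (cases p) auto
      have F: "forest_on N F" and T: "T \<in> F" and S: "S \<in> set (planted_grow z T)" using p p_eq by auto
      let ?G = "insert S (F - {T})"
      have G: "forest_on (insert z N) ?G" by (rule forest_on_grow[OF F T S z])
      have zT: "z \<notin> planted_labels U" if "U \<in> F" for U using forest_on_labels_subset[OF F that] zN by auto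
      have zS: "z \<in> planted_labels S" using planted_grow_labels[OF S] by simp
      have "S \<noteq> ?R" using S by (cases T) auto
      then have "?R \<notin> ?G" using zT[of ?R] by auto
      then show "(case p of (F, T, S) \<Rightarrow> insert S (F - {T})) \<in> {F. forest_on (insert z N) F \<and> ?R \<notin> F}"
        using p_eq G by auto
      have "holder ?G = S" by (rule holder_eq[OF G _ zS]) simp
      moreover have "planted_prune z S = T" by (rule planted_prune_grow[OF S zT[OF T]])
      moreover have "S \<notin> F" using zS zT by auto
      ultimately show "(insert (planted_prune z (holder (case p of (F, T, S) \<Rightarrow> insert S (F - {T}))))
          ((case p of (F, T, S) \<Rightarrow> insert S (F - {T})) - {holder (case p of (F, T, S) \<Rightarrow> insert S (F - {T}))}),
          planted_prune z (holder (case p of (F, T, S) \<Rightarrow> insert S (F - {T}))),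
          holder (case p of (F, T, S) \<Rightarrow> insert S (F - {T}))) = p"
        using p_eq T by auto
    qed
  qed
  also have "\<dots> = (\<Sum>F | forest_on N F. \<Sum>T\<in>F. \<Sum>S\<in>set (planted_grow z T). h (insert S (F - {T})))"
    using N fin by (subst sum.Sigma[symmetric]) (auto simp: sum.Sigma forest_on_finite intro!: sum.cong)
  finally show ?thesis by (simp add: sum.distrib)
qed

section \<open>The recurrence for weighted sums over forests\<close>

definition forest_coeff :: "'a::comm_ring_1 \<Rightarrow> 'v planted set \<Rightarrow> 'a" where
  "forest_coeff \<alpha> F = (\<Prod>T\<in>F. planted_coeff \<alpha> T)"

definition forest_linear :: "'v planted set \<Rightarrow> nat" where
  "forest_linear F = (\<Sum>T\<in>F. planted_linear T)"

definition forest_leaves :: "'v planted set \<Rightarrow> nat" where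
  "forest_leaves F = (\<Sum>T\<in>F. planted_leaves T)"

lemmas forest_stat_defs = forest_coeff_def forest_linear_def forest_leaves_def

lemma forest_weight_eq:
  "forest_weight x y \<alpha> F = forest_coeff \<alpha> F * ((x + y) ^ forest_linear F * (x * y) ^ forest_leaves F)"
  by (simp add: forest_weight_def forest_stat_defs planted_weight_eq prod.distrib power_sum)

text \<open>Growing acts on one tree at a time, like a derivation on a product; a new single root
  gives the \<alpha> term of \<open>growth_op\<close>.\<close>

lemma sum_forests_insert:
  fixes g :: "nat \<Rightarrow> nat \<Rightarrow> 'a::comm_ring_1" and N :: "'v::linorder set"
  assumes N: "finite N" and z: "\<forall>v\<in>N. v < z"
  shows "(\<Sum>F | forest_on (insert z N) F. forest_coeff \<alpha> F * g (forest_linear F) (forest_leaves F)) =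
    (\<Sum>F | forest_on N F. forest_coeff \<alpha> F * growth_op \<alpha> g (forest_linear F) (forest_leaves F))"
  unfolding sum_forest_on_insert[OF assms]
proof (intro sum.cong refl)
  fix F assume "F \<in> {F. forest_on N F}"
  then have F: "forest_on N F" by simp
  have fin: "finite F" by (rule forest_on_finite[OF F N])
  have zF: "z \<notin> planted_labels T" if "T \<in> F" for T
    using forest_on_labels_subset[OF F that] z by auto
  let ?h = "\<lambda>F. forest_coeff \<alpha> F * g (forest_linear F) (forest_leaves F)"
  let ?p = "forest_linear F" and ?q = "forest_leaves F" and ?c = "forest_coeff \<alpha> F"
  have ins: "?h (insert S G) = forest_coeff \<alpha> G * (planted_coeff \<alpha> S *
      g (forest_linear G + planted_linear S) (forest_leaves G + planted_leaves S))"
    if "finite G" "S \<notin> G" for S and G :: "'v planted set"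
    using that by (simp add: forest_stat_defs algebra_simps)
  have single: "?h (insert (SingleRoot z) F) = ?c * (\<alpha> * g (Suc ?p) ?q)"
    using zF[of "SingleRoot z"] by (subst ins) (auto simp: fin)
  have grown: "(\<Sum>S\<in>set (planted_grow z T). ?h (insert S (F - {T}))) =
      ?c * (2 * of_nat (planted_linear T) * g (?p - 1) (Suc ?q) + of_nat (planted_leaves T) * g (Suc ?p) ?q)"
    if T: "T \<in> F" for T
  proof -
    let ?G = "F - {T}"
    have G: "?c = planted_coeff \<alpha> T * forest_coeff \<alpha> ?G" "?p = planted_linear T + forest_linear ?G"
        "?q = planted_leaves T + forest_leaves ?G"
      using fin T by (simp_all add: forest_stat_defs prod.remove[of F T] sum.remove[of F T])
    have "S \<notin> ?G" if "S \<in> set (planted_grow z T)" for S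
      using zF planted_grow_labels[OF that] by auto
    then have "(\<Sum>S\<in>set (planted_grow z T). ?h (insert S ?G)) =
        forest_coeff \<alpha> ?G * (\<Sum>S\<in>set (planted_grow z T). planted_coeff \<alpha> S *
          g (forest_linear ?G + planted_linear S) (forest_leaves ?G + planted_leaves S))"
      using fin unfolding sum_distrib_left by (intro sum.cong ins) auto
    also have "\<dots> = forest_coeff \<alpha> ?G * (planted_coeff \<alpha> T *
        (2 * of_nat (planted_linear T) *
           g (forest_linear ?G + (planted_linear T - 1)) (forest_leaves ?G + Suc (planted_leaves T)) +
         of_nat (planted_leaves T) *
           g (forest_linear ?G + Suc (planted_linear T)) (forest_leaves ?G + planted_leaves T)))"
      \<comment> \<open>The other trees only shift the arguments of \<open>g\<close>.\<close>
      using sum_planted_grow[OF zF[OF T], of \<alpha> "\<lambda>p q. g (forest_linear ?G + p) (forest_leaves ?G + q)"]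
      by simp
    also have "\<dots> = ?c * (2 * of_nat (planted_linear T) * g (?p - 1) (Suc ?q) +
        of_nat (planted_leaves T) * g (Suc ?p) ?q)"
      \<comment> \<open>For a tree without linear part the two truncated subtractions may disagree,
        but their terms have factor zero.\<close>
      unfolding G by (cases "planted_linear T") (simp_all add: ac_simps)
    finally show ?thesis .
  qed
  \<comment> \<open>The values of \<open>g\<close> no longer depend on \<open>T\<close>, so the
    exponents of the trees add up to those of the forest.\<close>
  have "(\<Sum>T\<in>F. \<Sum>S\<in>set (planted_grow z T). ?h (insert S (F - {T}))) =
      ?c * (2 * of_nat ?p * g (?p - 1) (Suc ?q) + of_nat ?q * g (Suc ?p) ?q)"
    by (simp add: grown sum_distrib_left[symmetric] sum.distrib sum_distrib_right[symmetric]
        forest_linear_def[of F, THEN arg_cong[where f = of_nat], unfolded of_nat_sum]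
        forest_leaves_def[of F, THEN arg_cong[where f = of_nat], unfolded of_nat_sum])
  then show "?h (insert (SingleRoot z) F) + (\<Sum>T\<in>F. \<Sum>S\<in>set (planted_grow z T). ?h (insert S (F - {T}))) =
      ?c * growth_op \<alpha> g ?p ?q"
    unfolding single growth_op_def by (simp add: distrib_left)
qed

section \<open>Induction on the number of labels\<close>

lemma forest_on_empty: "forest_on {} F \<longleftrightarrow> F = {}"
  by (auto simp: forest_on_def partition_on_def)

text \<open>Both sides obey the same recurrence. The induction hypothesis is used for
  \<open>insertion_op \<alpha> f\<close> in place of \<open>f\<close>, which is why \<open>f\<close>
  must be arbitrary.\<close>

lemma sum_permutations_eq_sum_forests:
  fixes f :: "nat \<Rightarrow> nat \<Rightarrow> 'a::comm_ring_1"
  shows "(\<Sum>\<sigma> | \<sigma> permutes {1..Suc n}.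
      \<alpha> ^ (lrmin (Suc n) \<sigma> + rlmin (Suc n) \<sigma> - 2) * f (des (Suc n) \<sigma>) (asc (Suc n) \<sigma>)) =
    (\<Sum>F | forest_on {1..n} F. forest_coeff \<alpha> F * gamma_expand f (forest_linear F) (forest_leaves F))"
proof (induction n arbitrary: f)
  case 0
  \<comment> \<open>The identity and the empty forest each contribute \<open>f 0 0\<close>.\<close>
  have "lrmin 1 (\<lambda>i. i) = 1" "rlmin 1 (\<lambda>i. i) = 1" "des 1 (\<lambda>i. i) = 0" "asc 1 (\<lambda>i. i) = 0"
    by (simp_all add: lrmin_def rlmin_def des_def asc_def cong: conj_cong)
  then show ?case
    by (simp add: forest_on_empty forest_stat_defs gamma_expand_def)
next
  case (Suc n)
  have eq: "{1..Suc n} = insert (Suc n) {1..n}" by auto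
  have "(\<Sum>F | forest_on {1..Suc n} F. forest_coeff \<alpha> F * gamma_expand f (forest_linear F) (forest_leaves F)) =
      (\<Sum>F | forest_on {1..n} F.
        forest_coeff \<alpha> F * growth_op \<alpha> (gamma_expand f) (forest_linear F) (forest_leaves F))"
    unfolding eq by (rule sum_forests_insert) auto
  moreover have "1 \<le> Suc n" by simp
  note sum_permutations_insert[OF this, of \<alpha> f]
  ultimately show ?case by (simp only: Suc.IH gamma_expand_insertion_op)
qed

theorem theorem2p5:
  fixes x y \<alpha> :: "'a::comm_ring_1" and n :: nat
  assumes "n \<ge> 1"
  shows "alpha_Eulerian_star n x y \<alpha> = (\<Sum>F | forest_on {1..n} F. forest_weight x y \<alpha> F)"
  \<comment> \<open>Descents carry y and ascents x, because the star exchanges the two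
    variables.\<close>
  using sum_permutations_eq_sum_forests[where n = n and \<alpha> = \<alpha> and f = "\<lambda>d a. y ^ d * x ^ a"]
  unfolding gamma_expand_monomial
  by (simp add: alpha_Eulerian_star_def alpha_Eulerian_def forest_weight_eq mult.commute)

end
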